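(* In the setting of the context (including the exactness assumption), let $(\bar x_n,\bar y_n)_{n\in\mathcal N}$ be an optimal solution of the original problem and suppose the bounds satisfy $l_{n,\rho}\ge\sigma_n$ for all nodes $n\ne r$. For each node $n\neq r$ put $\bar x=\bar x_{a(n)}$, let $\hat v_n$ be the optimal value and $(\hat\lambda_n,\hat\rho_n)$ an optimal outer solution of $$\max_{(\lambda,\rho)\in\mathcal U_n}\ \min_{z\in\mathcal X_{a(n)}}\big[Q_n(z)+\langle\lambda,\bar x-z\rangle+\rho\,\psi_n(\bar x-z)\big],$$ and define the generalized conjugacy cut $C_n(x)=-\langle\hat\lambda_n,\bar x-x\rangle-\hat\rho_n\psi_n(\bar x-x)+\hat v_n$, $x\in\mathcal X_{a(n)}$. Then for every node $n\ne r$ the cut is tight at $\bar x_{a(n)}$, i.e. $Q_n(\bar x_{a(n)})=C_n(\bar x_{a(n)})$.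
   Context: $\mathcal N$ is the node set of a finite rooted scenario tree with root $r$; $a(n)$ is the parent and $\mathcal C(n)$ the set of children of $n$. $p_n>0$ is the probability of node $n$, $p_r=1$, $p_{nm}=p_m/p_n$ for $m\in\mathcal C(n)$. For each $n$, $\mathcal F_n$ is a compact set of pairs $(x_n,y_n)$ in a Euclidean space and $\mathcal X_n$ is its projection onto the $x_n$-coordinates; $x_{a(r)}=0$, $\mathcal X_{a(r)}=\{0\}$. The cost $f_n(z,y,x)\in[0,+\infty]$, defined for $z\in\mathcal X_{a(n)}$, $(x,y)\in\mathcal F_n$, is lower semicontinuous, and some choice of $(x_n,y_n)\in\mathcal F_n$, $n\in\mathcal N$, gives $\sum_n p_nf_n(x_{a(n)},y_n,x_n)<+\infty$. The original problem is $\min\{\sum_n p_nf_n(x_{a(n)},y_n,x_n):(x_n,y_n)\in\mathcal F_n\ \forall n\}$. Value functions, recursively from the leaves: $Q_n(x_{a(n)})=\min_{(x,y)\in\mathcal F_n}\{f_n(x_{a(n)},y,x)+\sum_{m\in\mathcal C(n)}p_{nm}Q_m(x)\}$. A penalty function is $\psi:\mathbb R^d\to\mathbb R_+$ with $\psi(x)=0$ iff $x=0$ and with the diameter of $\{\psi\le a\}$ tending to $0$ as $a\to0$. For each $n$ a penalty function $\psi_n$, 1-Lipschitz on $\mathcal X_{a(n)}-\mathcal X_{a(n)}$ with respect to a norm $\|\cdot\|$ (dual norm $\|\cdot\|_*$), and $\sigma_n>0$ are given. Exactness assumption: every optimal solution of $\min\{\sum_n p_n(f_n(z_n,y_n,x_n)+\sigma_n\psi_n(x_{a(n)}-z_n)):(x_n,y_n)\in\mathcal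 F_n,\ z_n\in\mathcal X_{a(n)}\ \forall n\}$ satisfies $z_n=x_{a(n)}$ for all $n$. For $n\ne r$, $\mathcal U_n=\{(\lambda,\rho):\|\lambda\|_*\le l_{n,\lambda},\ 0\le\rho\le l_{n,\rho}\}$ with given nonnegative bounds $l_{n,\lambda},l_{n,\rho}$. *)

theory Defs
  imports "HOL-Analysis.Analysis"
begin

section \<open>Norms, semicontinuity and penalty functions\<close>

text \<open>The norms considered are arbitrary norms on the state space, not necessarily the
  Euclidean norm of the type class.\<close>

definition is_norm :: "('x::real_vector \<Rightarrow> real) \<Rightarrow> bool" where
  "is_norm nrm \<longleftrightarrow>
     (\<forall>x. 0 \<le> nrm x) \<and> (\<forall>x. nrm x = 0 \<longleftrightarrow> x = 0) \<and>
     (\<forall>c x. nrm (c *\<^sub>R x) = \<bar>c\<bar> * nrm x) \<and>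
     (\<forall>x y. nrm (x + y) \<le> nrm x + nrm y)"

definition dual_norm :: "('x::euclidean_space \<Rightarrow> real) \<Rightarrow> 'x \<Rightarrow> real" where
  "dual_norm nrm l = (SUP x\<in>{x. nrm x \<le> 1}. l \<bullet> x)"

text \<open>At an isolated point of \<open>S\<close> the filter is trivial and the lower limit is
  \<open>\<infinity>\<close>, so the condition is void there.\<close>

definition lsc_on :: "'a::topological_space set \<Rightarrow> ('a \<Rightarrow> ereal) \<Rightarrow> bool" where
  "lsc_on S g \<longleftrightarrow> (\<forall>u\<in>S. g u \<le> Liminf (at u within S) g)"

text \<open>\<^const>\<open>diameter\<close> is only meaningful on bounded sets, so a diameter tending to
  \<open>0\<close> has to be accompanied by eventual boundedness.  For \<open>a < 0\<close> the sublevel set is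
  empty, hence the one-sided limit.\<close>

definition penalty_function :: "('x::euclidean_space \<Rightarrow> real) \<Rightarrow> bool" where
  "penalty_function psi \<longleftrightarrow>
     (\<forall>x. 0 \<le> psi x) \<and> (\<forall>x. psi x = 0 \<longleftrightarrow> x = 0) \<and>
     (\<forall>\<^sub>F a in at_right 0. bounded {x. psi x \<le> a}) \<and>
     ((\<lambda>a. diameter {x. psi x \<le> a}) \<longlongrightarrow> 0) (at_right 0)"

definition lipschitz1_wrt :: "('x::real_vector \<Rightarrow> real) \<Rightarrow> 'x set \<Rightarrow> ('x \<Rightarrow> real) \<Rightarrow> bool" where
  "lipschitz1_wrt nrm D psi \<longleftrightarrow> (\<forall>u\<in>D. \<forall>v\<in>D. \<bar>psi u - psi v\<bar> \<le> nrm (u - v))"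

section \<open>Programs on a scenario tree\<close>

record ('n, 'x, 'y) program =
  nodes :: "'n set"
  rootnode :: 'n
  parent :: "'n \<Rightarrow> 'n"
  node_prob :: "'n \<Rightarrow> real"
  feas :: "'n \<Rightarrow> ('x \<times> 'y) set"
  cost :: "'n \<Rightarrow> 'x \<Rightarrow> 'y \<Rightarrow> 'x \<Rightarrow> ereal"

definition children :: "('n, 'x, 'y) program \<Rightarrow> 'n \<Rightarrow> 'n set" where
  "children P n = {m \<in> nodes P. m \<noteq> rootnode P \<and> parent P m = n}"

text \<open>The value of \<^term>\<open>parent P\<close> at the root is irrelevant: the parent state of the root
  is fixed to \<open>0\<close> by \<open>parent_state\<close> and \<open>parent_states\<close> below.\<close>

locale scenario_tree =
  fixes P :: "('n, 'x, 'y) program"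
  assumes finite_nodes: "finite (nodes P)"
    and root_in_nodes: "rootnode P \<in> nodes P"
    and parent_in_nodes: "n \<in> nodes P \<Longrightarrow> n \<noteq> rootnode P \<Longrightarrow> parent P n \<in> nodes P"
    and reaches_root: "n \<in> nodes P \<Longrightarrow> \<exists>k. (parent P ^^ k) n = rootnode P"
    and prob_pos: "n \<in> nodes P \<Longrightarrow> 0 < node_prob P n"
    and prob_root: "node_prob P (rootnode P) = 1"
    and prob_children: "n \<in> nodes P \<Longrightarrow> children P n \<noteq> {} \<Longrightarrow>
      (\<Sum>m\<in>children P n. node_prob P m) = node_prob P n"
begin

definition depth :: "'n \<Rightarrow> nat" where
  "depth n = (LEAST k. (parent P ^^ k) n = rootnode P)"

lemma depth_child:
  assumes "m \<in> children P n"
  shows "depth m = Suc (depth n)"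
proof -
  have m: "m \<in> nodes P" "m \<noteq> rootnode P" "parent P m = n"
    using assms by (auto simp: children_def)
  obtain k where k: "(parent P ^^ k) m = rootnode P"
    using reaches_root[OF m(1)] by blast
  show ?thesis
    unfolding depth_def using Least_Suc[where P = "\<lambda>k. (parent P ^^ k) m = rootnode P", OF k] m(2,3)
    by (simp add: funpow_Suc_right del: funpow.simps)
qed

lemma wf_children: "wf {(m, n). m \<in> children P n}"
proof -
  have "{(m, n). m \<in> children P n} \<subseteq> Wellfounded.measure (\<lambda>n. Suc (Max (depth ` nodes P)) - depth n)"
  proof (clarsimp)
    fix m n assume c: "m \<in> children P n"
    then have "m \<in> nodes P" by (simp add: children_def)
    then have "depth m \<le> Max (depth ` nodes P)" using finite_nodes by simp
    with depth_child[OF c]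
    show "Suc (Max (depth ` nodes P)) - depth m < Suc (Max (depth ` nodes P)) - depth n"
      by simp
  qed
  then show ?thesis by (rule wf_subset[OF wf_measure])
qed

context
  notes sum.cong [fundef_cong]
begin

text \<open>Minima of values are infima in \<^typ>\<open>ereal\<close>.\<close>

function value_fn :: "'n \<Rightarrow> 'x \<Rightarrow> ereal" where
  "value_fn n z =
     (INF (x, y)\<in>feas P n. cost P n z y x +
        (\<Sum>m\<in>children P n. ereal (node_prob P m / node_prob P n) * value_fn m x))"
  by auto
termination
proof
  show "wf (inv_image {(m, n). m \<in> children P n} fst)"
    by (rule wf_inv_image[OF wf_children])
qed auto

end

declare value_fn.simps [simp del]

end

definition parent_state ::
    "('n, 'x::zero, 'y) program \<Rightarrow> ('n \<Rightarrow> 'x) \<Rightarrow> 'n \<Rightarrow> 'x" where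
  "parent_state P x n = (if n = rootnode P then 0 else x (parent P n))"

definition parent_states :: "('n, 'x::zero, 'y) program \<Rightarrow> 'n \<Rightarrow> 'x set" where
  "parent_states P n = (if n = rootnode P then {0} else fst ` feas P (parent P n))"

definition feasible_sol :: "('n, 'x, 'y) program \<Rightarrow> ('n \<Rightarrow> 'x) \<times> ('n \<Rightarrow> 'y) \<Rightarrow> bool" where
  "feasible_sol P = (\<lambda>(x, y). \<forall>n\<in>nodes P. (x n, y n) \<in> feas P n)"

definition total_cost ::
    "('n, 'x::zero, 'y) program \<Rightarrow> ('n \<Rightarrow> 'x) \<times> ('n \<Rightarrow> 'y) \<Rightarrow> ereal" where
  "total_cost P = (\<lambda>(x, y).
     \<Sum>n\<in>nodes P. ereal (node_prob P n) * cost P n (parent_state P x n) (y n) (x n))"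

definition reg_feasible_sol ::
    "('n, 'x::zero, 'y) program \<Rightarrow> ('n \<Rightarrow> 'x) \<times> ('n \<Rightarrow> 'y) \<times> ('n \<Rightarrow> 'x) \<Rightarrow> bool" where
  "reg_feasible_sol P = (\<lambda>(x, y, z).
     \<forall>n\<in>nodes P. (x n, y n) \<in> feas P n \<and> z n \<in> parent_states P n)"

definition reg_total_cost ::
    "('n, 'x::ab_group_add, 'y) program \<Rightarrow> ('n \<Rightarrow> real) \<Rightarrow> ('n \<Rightarrow> 'x \<Rightarrow> real) \<Rightarrow>
     ('n \<Rightarrow> 'x) \<times> ('n \<Rightarrow> 'y) \<times> ('n \<Rightarrow> 'x) \<Rightarrow> ereal" where
  "reg_total_cost P sig psi = (\<lambda>(x, y, z).
     \<Sum>n\<in>nodes P. ereal (node_prob P n) *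
       (cost P n (z n) (y n) (x n) + ereal (sig n * psi n (parent_state P x n - z n))))"

definition exact_penalty ::
    "('n, 'x::ab_group_add, 'y) program \<Rightarrow> ('n \<Rightarrow> real) \<Rightarrow> ('n \<Rightarrow> 'x \<Rightarrow> real) \<Rightarrow> bool" where
  "exact_penalty P sig psi \<longleftrightarrow>
     (\<forall>x y z. is_arg_min (reg_total_cost P sig psi) (reg_feasible_sol P) (x, y, z) \<longrightarrow>
        (\<forall>n\<in>nodes P. z n = parent_state P x n))"

section \<open>Generalized conjugacy cuts\<close>

definition dual_set :: "('x::euclidean_space \<Rightarrow> real) \<Rightarrow> real \<Rightarrow> real \<Rightarrow> ('x \<times> real) set" where
  "dual_set nrm l_lam l_rho = {(lam, rho). dual_norm nrm lam \<le> l_lam \<and> 0 \<le> rho \<and> rho \<le> l_rho}"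

definition inner_value ::
    "('n, 'x::euclidean_space, 'y) program \<Rightarrow> ('n \<Rightarrow> 'x \<Rightarrow> real) \<Rightarrow> 'n \<Rightarrow> 'x \<Rightarrow> 'x \<times> real \<Rightarrow> ereal"
  where
  "inner_value P psi n xb = (\<lambda>(lam, rho). INF z\<in>parent_states P n.
     scenario_tree.value_fn P n z + ereal (lam \<bullet> (xb - z) + rho * psi n (xb - z)))"

definition conjugacy_cut ::
    "('x::euclidean_space \<Rightarrow> real) \<Rightarrow> 'x \<Rightarrow> 'x \<Rightarrow> real \<Rightarrow> ereal \<Rightarrow> 'x \<Rightarrow> ereal" where
  "conjugacy_cut psi xb lam rho v x = ereal (- (lam \<bullet> (xb - x)) - rho * psi (xb - x)) + v"

end

theory Submission
  imports Defs
begin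

text \<open>
  The cut is tight as soon as \<open>(0, \<sigma>\<^sub>n)\<close>, which lies in the dual set, is a good enough multiplier,
  that is, \<open>Q\<^sub>n(x) \<le> Q\<^sub>n(z) + \<sigma>\<^sub>n \<psi>\<^sub>n(x - z)\<close> for \<open>x\<close> the optimal parent state and all \<open>z\<close>.  The
  regularized problem attains its minimum by compactness and lower semicontinuity, so exactness
  says that its value is the original optimal value.  If the inequality failed for some \<open>z\<close>, one
  could follow the optimal solution, replace the parent state of \<open>n\<close> by \<open>z\<close> at the price of the
  penalty, and continue nearly optimally below \<open>n\<close>, which would beat the optimal value.
\<close>

section \<open>Lower semicontinuity and norms\<close>

lemma lsc_on_iff:
  "lsc_on S g \<longleftrightarrow> (\<forall>u\<in>S. \<forall>c < g u. \<forall>\<^sub>F v in at u within S. c < g v)"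
  by (auto simp: lsc_on_def le_Liminf_iff)

lemma lsc_on_compose:
  assumes g: "lsc_on S g" and h: "continuous_on T h" "h ` T \<subseteq> S"
  shows "lsc_on T (\<lambda>u. g (h u))"
  unfolding lsc_on_iff
proof (intro ballI allI impI)
  fix u c
  assume u: "u \<in> T" and c: "c < g (h u)"
  have "\<forall>\<^sub>F v in at (h u) within S. c < g v"
    using g c u h(2) unfolding lsc_on_iff by blast
  then obtain U where U: "open U" "h u \<in> U"
      "\<And>v. v \<in> U \<Longrightarrow> v \<noteq> h u \<Longrightarrow> v \<in> S \<Longrightarrow> c < g v"
    unfolding eventually_at_topological by blast
  have "(h \<longlongrightarrow> h u) (at u within T)"
    using h(1) u by (auto simp: continuous_on_def)
  then have "\<forall>\<^sub>F v in at u within T. h v \<in> U"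
    using U(1,2) by (rule topological_tendstoD)
  moreover have "\<forall>\<^sub>F v in at u within T. v \<in> T"
    by (auto simp: eventually_at_topological)
  ultimately show "\<forall>\<^sub>F v in at u within T. c < g (h v)"
  proof eventually_elim
    case (elim v)
    \<comment> \<open>\<open>U\<close> controls \<open>g\<close> on a punctured neighbourhood only,
      and \<open>h\<close> may take the value \<open>h u\<close> at points other than
      \<open>u\<close>; there \<open>g (h v)\<close> is \<open>g (h u)\<close> itself, which exceeds
      \<open>c\<close>.\<close>
    then show ?case using U(3)[of "h v"] c h(2) by (cases "h v = h u") auto
  qed
qed

lemma lsc_on_continuous:
  assumes "continuous_on S (f :: _ \<Rightarrow> real)"
  shows "lsc_on S (\<lambda>u. ereal (f u))"
  unfolding lsc_on_iff
proof (intro ballI allI impI)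
  fix u c assume "u \<in> S" "c < ereal (f u)"
  moreover have "((\<lambda>u. ereal (f u)) \<longlongrightarrow> ereal (f u)) (at u within S)"
    using assms \<open>u \<in> S\<close> by (auto simp: continuous_on_def)
  ultimately show "\<forall>\<^sub>F v in at u within S. c < ereal (f v)"
    by (auto intro: order_tendstoD)
qed

lemma lsc_on_add:
  assumes "lsc_on S f" "lsc_on S g"
    and nn: "\<And>u. u \<in> S \<Longrightarrow> 0 \<le> f u" "\<And>u. u \<in> S \<Longrightarrow> 0 \<le> g u"
  shows "lsc_on S (\<lambda>u. f u + g u)"
  unfolding lsc_on_def
proof
  fix u assume u: "u \<in> S"
  let ?F = "at u within S"
  have ev: "\<forall>\<^sub>F v in ?F. v \<in> S"
    by (auto simp: eventually_at_topological)
  show "f u + g u \<le> Liminf ?F (\<lambda>u. f u + g u)"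
  \<comment> \<open>At an isolated point the filter is trivial and the lower limit is \<infinity>.
    Elsewhere the lower limit is superadditive, nonnegativity ruling out undefined sums.\<close>
  proof (cases "?F = bot")
    case False
    have "f u + g u \<le> Liminf ?F f + Liminf ?F g"
      using assms(1,2) u by (auto simp: lsc_on_def intro: add_mono)
    also have "\<dots> \<le> Liminf ?F (\<lambda>u. f u + g u)"
      by (rule Liminf_add_le) (use False ev nn in \<open>auto elim: eventually_mono\<close>)
    finally show ?thesis .
  qed simp
qed

lemma lsc_on_cmult:
  assumes "lsc_on S f" "0 \<le> (c::real)"
  shows "lsc_on S (\<lambda>u. ereal c * f u)"
  unfolding lsc_on_def
proof
  fix u assume u: "u \<in> S"
  let ?F = "at u within S"
  show "ereal c * f u \<le> Liminf ?F (\<lambda>u. ereal c * f u)"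
  proof (cases "?F = bot")
    case False
    have "ereal c * f u \<le> ereal c * Liminf ?F f"
      using assms u by (auto simp: lsc_on_def intro!: ereal_mult_left_mono)
    then show ?thesis
      using False assms(2) by (simp add: Liminf_ereal_mult_left)
  qed simp
qed

lemma lsc_on_sum:
  assumes "\<And>i. i \<in> I \<Longrightarrow> lsc_on S (f i)" "\<And>i u. i \<in> I \<Longrightarrow> u \<in> S \<Longrightarrow> 0 \<le> f i u"
  shows "lsc_on S (\<lambda>u. \<Sum>i\<in>I. f i u)"
  using assms
proof (induction I rule: infinite_finite_induct)
  case (insert i I)
  then show ?case by (auto intro!: lsc_on_add sum_nonneg)
qed (auto simp: lsc_on_iff)

section \<open>Compactness and attained minima\<close>

lemma lsc_on_attains_inf:
  assumes S: "compact S" "S \<noteq> {}" and g: "lsc_on S g"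
  shows "\<exists>u\<in>S. \<forall>v\<in>S. g u \<le> g v"
proof (rule ccontr)
  assume "\<not> ?thesis"
  then have "\<forall>u\<in>S. \<exists>v\<in>S. g v < g u" by (meson not_le)
  then obtain w where w: "\<And>u. u \<in> S \<Longrightarrow> w u \<in> S \<and> g (w u) < g u" by metis
  \<comment> \<open>Each \<open>u\<close> gets a neighbourhood on which \<open>g\<close> exceeds
    \<open>g (w u)\<close>. In a finite subcover the smallest of these values is taken at a point of
    \<open>S\<close>; that point lies in one of the neighbourhoods, whose own value is then still
    smaller. Arguing with covers makes this applicable to the product topology.\<close>
  have "\<exists>U. open U \<and> u \<in> U \<and> (\<forall>v\<in>U \<inter> S. g (w u) < g v)" if "u \<in> S" for u
  proof -
    have "\<forall>\<^sub>F v in at u within S. g (w u) < g v"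
      using g w[OF that] that unfolding lsc_on_iff by blast
    then obtain U where "open U" "u \<in> U" "\<And>v. v \<in> U \<Longrightarrow> v \<noteq> u \<Longrightarrow> v \<in> S \<Longrightarrow> g (w u) < g v"
      unfolding eventually_at_topological by blast
    with w[OF that] show ?thesis by (metis IntE)
  qed
  then obtain U where U: "\<And>u. u \<in> S \<Longrightarrow> open (U u)" "\<And>u. u \<in> S \<Longrightarrow> u \<in> U u"
      "\<And>u v. u \<in> S \<Longrightarrow> v \<in> U u \<Longrightarrow> v \<in> S \<Longrightarrow> g (w u) < g v"
    unfolding Ball_def Int_iff by metis
  obtain D where D: "D \<subseteq> S" "finite D" "S \<subseteq> (\<Union>u\<in>D. U u)"
    using compactE_image[OF S(1), of S U] U(1,2) by blast
  with S(2) have "D \<noteq> {}" by auto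
  then have "Min ((\<lambda>u. g (w u)) ` D) \<in> (\<lambda>u. g (w u)) ` D"
    using D(2) by simp
  then obtain u where u: "u \<in> D" "g (w u) = Min ((\<lambda>u. g (w u)) ` D)" by auto
  with D have "w u \<in> S" using w by auto
  then obtain u' where "u' \<in> D" "w u \<in> U u'" using D(3) by auto
  then have "g (w u') < g (w u)" using U(3) D(1) \<open>w u \<in> S\<close> by auto
  moreover have "g (w u) \<le> g (w u')"
    using u(2) D(2) \<open>u' \<in> D\<close> by simp
  ultimately show False by simp
qed

text \<open>Tychonoff's theorem, carried over from the abstract product topology to the topology of
  the function type.\<close>

lemma compact_Pi_UNIV:
  fixes K :: "'i \<Rightarrow> 'a::topological_space set"
  assumes "\<And>i. compact (K i)"
  shows "compact (Pi UNIV K)"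
proof -
  have "compactin (product_topology (\<lambda>i. euclidean) UNIV) (PiE UNIV K)"
    using assms by (simp add: compactin_PiE)
  then show ?thesis
    by (simp add: euclidean_product_topology PiE_UNIV_domain)
qed

section \<open>Comparison of an arbitrary norm with the Euclidean one\<close>

lemma is_norm_le_norm:
  fixes nrm :: "'x::euclidean_space \<Rightarrow> real"
  assumes "is_norm nrm"
  shows "\<exists>C\<ge>0. \<forall>x. nrm x \<le> C * norm x"
proof (intro exI conjI allI)
  have nn: "\<And>x. 0 \<le> nrm x" and sc: "\<And>c x. nrm (c *\<^sub>R x) = \<bar>c\<bar> * nrm x"
    and tri: "\<And>x y. nrm (x + y) \<le> nrm x + nrm y"
    and z: "nrm 0 = 0"
    using assms by (auto simp: is_norm_def)
  \<comment> \<open>The constant is the sum of the norms of the basis vectors: \<open>x\<close> is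
    expanded in coordinates, each at most \<open>norm x\<close> in absolute value.\<close>
  show "0 \<le> (\<Sum>b\<in>Basis. nrm b)" by (simp add: nn sum_nonneg)
  fix x
  have sum: "nrm (sum f A) \<le> (\<Sum>b\<in>A. nrm (f b))" for f :: "'x \<Rightarrow> 'x" and A
  proof (induction A rule: infinite_finite_induct)
    case (insert a A)
    then show ?case using tri[of "f a" "sum f A"] by simp
  qed (simp_all add: z)
  have "nrm x = nrm (\<Sum>b\<in>Basis. (x \<bullet> b) *\<^sub>R b)"
    by (simp add: euclidean_representation)
  also have "\<dots> \<le> (\<Sum>b\<in>Basis. \<bar>x \<bullet> b\<bar> * nrm b)"
    using sum[of "\<lambda>b. (x \<bullet> b) *\<^sub>R b" Basis] by (simp add: sc)
  also have "\<dots> \<le> (\<Sum>b\<in>Basis. norm x * nrm b)"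
    by (intro sum_mono mult_right_mono Basis_le_norm nn)
  also have "\<dots> = (\<Sum>b\<in>Basis. nrm b) * norm x"
    by (simp add: sum_distrib_left mult.commute)
  finally show "nrm x \<le> (\<Sum>b\<in>Basis. nrm b) * norm x" .
qed

text \<open>This supplies the semicontinuity of the penalty terms. A penalty function may be
  discontinuous away from 0, so continuity has to come from the Lipschitz bound and is confined to
  \<open>D\<close>.\<close>

lemma lipschitz1_wrt_continuous_on:
  fixes psi :: "'x::euclidean_space \<Rightarrow> real"
  assumes "is_norm nrm" "lipschitz1_wrt nrm D psi"
  shows "continuous_on D psi"
proof -
  obtain C where C: "0 \<le> C" "\<And>x. nrm x \<le> C * norm x"
    using is_norm_le_norm[OF assms(1)] by blast
  have "C-lipschitz_on D psi"
  proof (rule lipschitz_onI)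
    fix u v assume "u \<in> D" "v \<in> D"
    then have "\<bar>psi u - psi v\<bar> \<le> nrm (u - v)"
      using assms(2) by (simp add: lipschitz1_wrt_def)
    also have "\<dots> \<le> C * norm (u - v)" by (rule C(2))
    finally show "dist (psi u) (psi v) \<le> C * dist u v" by (simp add: dist_norm)
  qed (rule C)
  then show ?thesis by (rule lipschitz_on_continuous_on)
qed

lemma dual_norm_zero:
  assumes "is_norm nrm"
  shows "dual_norm nrm 0 = 0"
proof -
  \<comment> \<open>The unit ball contains 0, so the supremum of the constant 0 is taken over a
    nonempty set.\<close>
  have "{x. nrm x \<le> 1} \<noteq> {}" using assms by (metis (mono_tags) empty_iff is_norm_def mem_Collect_eq zero_le_one)
  then show ?thesis by (simp add: dual_norm_def)
qed

section \<open>Value functions on the tree\<close>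

text \<open>Tailored to the end of \<open>restart_policy\<close>: \<open>a\<close>, \<open>b\<close>
  and \<open>q\<close> are the collected value functions on both sides. Only these must be finite;
  the policy costs \<open>t\<close> and \<open>s\<close> may be infinite.\<close>

lemma ereal_cancel:
  fixes t u a q b s v d :: ereal
  assumes "t + (u + a) + (q + b) \<le> s + b + (q + (v + a)) + d"
    and "\<bar>a\<bar> \<noteq> \<infinity>" "\<bar>b\<bar> \<noteq> \<infinity>" "\<bar>q\<bar> \<noteq> \<infinity>"
  shows "t + u \<le> s + v + d"
proof -
  obtain a' b' q' where [simp]: "a = ereal a'" "b = ereal b'" "q = ereal q'"
    using assms(2-4) by auto
  have "(t + u) + ereal (a' + b' + q') \<le> (s + v + d) + ereal (a' + b' + q')"
    using assms(1) by (simp add: plus_ereal.simps(1)[symmetric] ac_simps del: plus_ereal.simps)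
  moreover have "x \<le> y" if "x + ereal r \<le> y + ereal r" for x y r
    using that by (cases x; cases y) auto
  ultimately show ?thesis by blast
qed

text \<open>Chain the two inequalities, cancel \<open>c\<close> and divide by \<open>p\<close>. In
  the application \<open>t\<close> is the optimal value, \<open>c\<close> the cost of a competitor
  without its penalty, and \<open>p * r\<close> that penalty.\<close>

lemma ereal_combine:
  fixes t c u v :: ereal and p r e :: real
  assumes le: "c + ereal p * u \<le> t + ereal p * v + ereal (p * e)" "t \<le> c + ereal (p * r)"
    and p: "0 < p" and t: "0 \<le> t" "t < \<infinity>" and v: "0 \<le> v" "v \<noteq> \<infinity>" and u: "0 \<le> u"
  shows "u \<le> v + ereal r + ereal e"
proof -
  obtain t' v' where [simp]: "t = ereal t'" "v = ereal v'"
    using t v by (cases t; cases v) auto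
  \<comment> \<open>The first inequality excludes \<infinity>, its right side being finite and
    \<open>u\<close> nonnegative; the second excludes -\<infinity>, since \<open>t\<close> is
    nonnegative.\<close>
  have "c \<noteq> \<infinity>" "c \<noteq> -\<infinity>" using le p u by (auto split: if_splits)
  then obtain c' where [simp]: "c = ereal c'" by (cases c) auto
  show ?thesis
  proof (cases u)
    case (real u')
    then have "p * u' \<le> p * (v' + r + e)"
      using le by (simp add: distrib_left)
    then show ?thesis using p real by simp
  qed (use le(1) p u in auto)
qed

section \<open>Stage values and policy costs for nonnegative costs\<close>

locale nonneg_program = scenario_tree P
  for P :: "('n, 'x::zero, 'y) program" +
  assumes cost_nonneg: "\<And>n z x y. n \<in> nodes P \<Longrightarrow> z \<in> parent_states P n \<Longrightarrow>
    (x, y) \<in> feas P n \<Longrightarrow> 0 \<le> cost P n z y x"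
begin

definition stage_value :: "'n \<Rightarrow> 'x \<Rightarrow> 'x \<times> 'y \<Rightarrow> ereal" where
  "stage_value n z w = cost P n z (snd w) (fst w) +
     (\<Sum>m\<in>children P n. ereal (node_prob P m / node_prob P n) * value_fn m (fst w))"

text \<open>The incoming states \<open>z\<close> are independent of the decisions \<open>w\<close>,
  so that the same expression serves the original problem and the one with decoupled states.\<close>

definition policy_cost :: "('n \<Rightarrow> 'x) \<Rightarrow> ('n \<Rightarrow> 'x \<times> 'y) \<Rightarrow> ereal" where
  "policy_cost z w = (\<Sum>n\<in>nodes P. ereal (node_prob P n) * cost P n (z n) (snd (w n)) (fst (w n)))"

abbreviation expected_value :: "'n \<Rightarrow> 'x \<Rightarrow> ereal" where
  "expected_value n z \<equiv> ereal (node_prob P n) * value_fn n z"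

lemma value_fn_eq_INF: "value_fn n z = (INF w\<in>feas P n. stage_value n z w)"
  by (subst value_fn.simps) (simp add: stage_value_def case_prod_beta)

lemma value_fn_le_stage_value: "w \<in> feas P n \<Longrightarrow> value_fn n z \<le> stage_value n z w"
  unfolding value_fn_eq_INF by (rule INF_lower)

lemma children_parent_states:
  "m \<in> children P n \<Longrightarrow> w \<in> feas P n \<Longrightarrow> fst w \<in> parent_states P m"
  by (auto simp: children_def parent_states_def)

lemma value_fn_nonneg:
  assumes "n \<in> nodes P" "z \<in> parent_states P n"
  shows "0 \<le> value_fn n z"
  using wf_children assms
proof (induction n arbitrary: z rule: wf_induct_rule)
  case (less n)
  show ?case
    unfolding value_fn_eq_INF
  proof (rule INF_greatest)
    fix w assume w: "w \<in> feas P n"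
    have "0 \<le> ereal (node_prob P m / node_prob P n) * value_fn m (fst w)" if "m \<in> children P n" for m
    proof -
      have "m \<in> nodes P" using that by (simp add: children_def)
      then have "0 < node_prob P m" "0 < node_prob P n" using prob_pos less.prems by auto
      then show ?thesis
        using less.IH[of m "fst w"] that children_parent_states[OF that w] \<open>m \<in> nodes P\<close> by simp
    qed
    then show "0 \<le> stage_value n z w"
      using cost_nonneg[of n z "fst w" "snd w"] less.prems w
      by (auto simp: stage_value_def intro!: add_nonneg_nonneg sum_nonneg)
  qed
qed

text \<open>Multiplying by the probability of \<open>n\<close> turns the conditional probabilities
  of the children into absolute ones, which lets the value functions of different stages
  cancel.\<close>

lemma expected_stage_value:
  assumes n: "n \<in> nodes P" and z: "z \<in> parent_states P n" and w: "w \<in> feas P n"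
  shows "ereal (node_prob P n) * stage_value n z w =
    ereal (node_prob P n) * cost P n z (snd w) (fst w) +
    (\<Sum>m\<in>children P n. expected_value m (fst w))"
proof -
  have pos: "0 < node_prob P n" using prob_pos n .
  have nn: "0 \<le> ereal (node_prob P m / node_prob P n) * value_fn m (fst w)"
    if "m \<in> children P n" for m
  proof -
    have "m \<in> nodes P" using that by (simp add: children_def)
    then show ?thesis
      using pos prob_pos[of m] value_fn_nonneg[of m "fst w"] children_parent_states[OF that w]
      by (simp add: less_imp_le)
  qed
  have "ereal (node_prob P n) * stage_value n z w =
    ereal (node_prob P n) * cost P n z (snd w) (fst w) +
    ereal (node_prob P n) *
      (\<Sum>m\<in>children P n. ereal (node_prob P m / node_prob P n) * value_fn m (fst w))"
    unfolding stage_value_def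
    by (rule ereal_right_distrib)
      (use nn cost_nonneg[of n z "fst w" "snd w"] n z w in \<open>auto intro!: sum_nonneg\<close>)
  also have "ereal (node_prob P n) *
      (\<Sum>m\<in>children P n. ereal (node_prob P m / node_prob P n) * value_fn m (fst w)) =
    (\<Sum>m\<in>children P n. expected_value m (fst w))"
    using pos nn by (subst sum_ereal_right_distrib) (auto simp: mult.assoc[symmetric])
  finally show ?thesis .
qed

text \<open>Each non-root node is a child of exactly one node, so the expected value functions
  of all non-root nodes are collected exactly once.\<close>

lemma expected_stage_value_sum:
  assumes w: "\<And>n. n \<in> nodes P \<Longrightarrow> w n \<in> feas P n"
    and z: "\<And>n. n \<in> nodes P \<Longrightarrow> z n \<in> parent_states P n"
  shows "(\<Sum>n\<in>nodes P. ereal (node_prob P n) * stage_value n (z n) (w n)) =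
    policy_cost z w + (\<Sum>m\<in>nodes P - {rootnode P}. expected_value m (fst (w (parent P m))))"
proof -
  have "(\<Sum>n\<in>nodes P. ereal (node_prob P n) * stage_value n (z n) (w n)) =
    policy_cost z w + (\<Sum>n\<in>nodes P. \<Sum>m\<in>children P n. expected_value m (fst (w n)))"
    by (simp add: expected_stage_value w z sum.distrib policy_cost_def)
  also have "(\<Sum>n\<in>nodes P. \<Sum>m\<in>children P n. expected_value m (fst (w n))) =
    (\<Sum>n\<in>nodes P. \<Sum>m\<in>{m \<in> nodes P - {rootnode P}. parent P m = n}.
       expected_value m (fst (w (parent P m))))"
    by (intro sum.cong refl) (auto simp: children_def)
  also have "\<dots> = (\<Sum>m\<in>nodes P - {rootnode P}. expected_value m (fst (w (parent P m))))"
    by (rule sum.group) (use finite_nodes parent_in_nodes in auto)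
  finally show ?thesis .
qed

section \<open>Induction and recursion from the root downwards\<close>

lemma depth_root: "depth (rootnode P) = 0"
  by (simp add: depth_def)

lemma depth_parent:
  "n \<in> nodes P \<Longrightarrow> n \<noteq> rootnode P \<Longrightarrow> depth n = Suc (depth (parent P n))"
  by (rule depth_child) (simp add: children_def)

text \<open>Induction on the depth, running against the direction of \<open>wf_children\<close>,
  which starts at the leaves.\<close>

lemma node_induct [consumes 1, case_names root child]:
  assumes "n \<in> nodes P" "Q (rootnode P)"
    and "\<And>n. n \<in> nodes P \<Longrightarrow> n \<noteq> rootnode P \<Longrightarrow> Q (parent P n) \<Longrightarrow> Q n"
  shows "Q n"
  using assms(1)
proof (induction "depth n" arbitrary: n)
  case 0
  then show ?case using depth_parent assms(2) by force
next
  case (Suc d)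
  then show ?case
    using depth_parent[of n] parent_in_nodes[of n] assms(2,3) by (cases "n = rootnode P") auto
qed

lemma policy_trajectory_exists:
  fixes F :: "'n \<Rightarrow> 'x \<Rightarrow> 'x \<times> 'y"
  shows "\<exists>w. \<forall>n\<in>nodes P. w n = F n (parent_state P (\<lambda>k. fst (w k)) n)"
proof -
  \<comment> \<open>\<open>S d\<close> is meant only for nodes of depth \<open>d\<close>, where it
    applies \<open>F\<close> to the state chosen by \<open>S (d - 1)\<close> at the parent. The
    trajectory is read off at \<open>S (depth k) k\<close>.\<close>
  define S where "S = rec_nat (\<lambda>k. F k 0) (\<lambda>d f k. F k (fst (f (parent P k))))"
  have "S (depth n) n = F n (parent_state P (\<lambda>k. fst (S (depth k) k)) n)" if "n \<in> nodes P" for n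
    using that by (cases "n = rootnode P") (auto simp: S_def parent_state_def depth_root depth_parent)
  then show ?thesis by (intro exI[of _ "\<lambda>k. S (depth k) k"]) blast
qed

lemma parent_state_in_parent_states:
  assumes "\<And>n. n \<in> nodes P \<Longrightarrow> w n \<in> feas P n" "n \<in> nodes P"
  shows "parent_state P (\<lambda>k. fst (w k)) n \<in> parent_states P n"
  using assms parent_in_nodes by (auto simp: parent_state_def parent_states_def)

section \<open>Finiteness and near optimality\<close>

lemma cost_finite:
  assumes w: "\<And>n. n \<in> nodes P \<Longrightarrow> w n \<in> feas P n"
    and z: "\<And>n. n \<in> nodes P \<Longrightarrow> z n \<in> parent_states P n"
    and fin: "policy_cost z w < \<infinity>" and n: "n \<in> nodes P"
  shows "cost P n (z n) (snd (w n)) (fst (w n)) < \<infinity>"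
proof -
  have "ereal (node_prob P n) * cost P n (z n) (snd (w n)) (fst (w n)) \<noteq> \<infinity>"
    using fin n finite_nodes unfolding policy_cost_def by (auto simp: sum_Pinfty)
  then show ?thesis using prob_pos[OF n] by auto
qed

lemma stage_value_finite_iff:
  assumes n: "n \<in> nodes P" and z: "z \<in> parent_states P n" and w: "w \<in> feas P n"
  shows "stage_value n z w < \<infinity> \<longleftrightarrow> cost P n z (snd w) (fst w) < \<infinity> \<and>
    (\<forall>m\<in>children P n. value_fn m (fst w) < \<infinity>)"
proof -
  have fin: "finite (children P n)" using finite_nodes by (simp add: children_def)
  \<comment> \<open>Positivity of the factor matters: a factor 0 would hide an infinite value, since
    0 times \<infinity> is 0.\<close>
  have "ereal (node_prob P m / node_prob P n) * value_fn m (fst w) = \<infinity> \<longleftrightarrow> value_fn m (fst w) = \<infinity>"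
    if "m \<in> children P n" for m
  proof -
    have "m \<in> nodes P" using that by (simp add: children_def)
    then have "0 < node_prob P m / node_prob P n" using prob_pos n by simp
    moreover have "0 \<le> value_fn m (fst w)"
      using value_fn_nonneg \<open>m \<in> nodes P\<close> children_parent_states[OF that w] by blast
    ultimately show ?thesis by (cases "value_fn m (fst w)") auto
  qed
  then show ?thesis
    using fin by (auto simp: stage_value_def sum_Pinfty)
qed

text \<open>Finiteness climbs from the leaves: the value function of a child is at most the stage
  value of the decision that the policy takes there.\<close>

lemma stage_value_finite:
  assumes w: "\<And>n. n \<in> nodes P \<Longrightarrow> w n \<in> feas P n"
    and fin: "policy_cost (parent_state P (\<lambda>k. fst (w k))) w < \<infinity>" and n: "n \<in> nodes P"
  shows "stage_value n (parent_state P (\<lambda>k. fst (w k)) n) (w n) < \<infinity>"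
  using wf_children n
proof (induction n rule: wf_induct_rule)
  case (less n)
  have "value_fn m (fst (w n)) < \<infinity>" if "m \<in> children P n" for m
  proof -
    have m: "m \<in> nodes P" "parent_state P (\<lambda>k. fst (w k)) m = fst (w n)"
      using that by (auto simp: children_def parent_state_def)
    have "value_fn m (fst (w n)) \<le> stage_value m (fst (w n)) (w m)"
      by (rule value_fn_le_stage_value) (rule w[OF m(1)])
    also have "\<dots> < \<infinity>" using less.IH[of m] that m by simp
    finally show ?thesis .
  qed
  moreover have ps: "parent_state P (\<lambda>k. fst (w k)) n \<in> parent_states P n" if "n \<in> nodes P" for n
    using parent_state_in_parent_states[of w, OF w that] .
  ultimately show ?case
    using cost_finite[of w, OF w ps fin less.prems] w less.prems
    by (subst stage_value_finite_iff) auto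
qed

text \<open>Decisions within \<open>e\<close> of the infimum suffice, as this slack is sent to 0 at
  the end; attainment in the recursion is thus bypassed. If the value is \<infinity>, any feasible
  decision will do.\<close>

lemma near_optimal_stage:
  assumes "n \<in> nodes P" "z \<in> parent_states P n" "feas P n \<noteq> {}" "0 < (e::real)"
  shows "\<exists>w\<in>feas P n. stage_value n z w \<le> value_fn n z + ereal e"
proof (cases "value_fn n z = \<infinity>")
  case False
  with value_fn_nonneg[OF assms(1,2)] have "value_fn n z < value_fn n z + ereal e"
    using assms(4) by (cases "value_fn n z") auto
  then show ?thesis
    unfolding value_fn_eq_INF[of n z] INF_less_iff by (auto intro: less_imp_le)
qed (use assms(3) in auto)

text \<open>The new decisions repeat \<open>wb\<close> in every node whose incoming state is the one of
  \<open>wb\<close>, and are nearly optimal elsewhere.  Then, node by node, the stage value minus the value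
  function exceeds the same difference for \<open>wb\<close> by at most \<open>e\<close>, and summing over the tree
  all value functions cancel except those at \<open>n0\<close>.\<close>

lemma restart_policy:
  assumes wb: "\<And>n. n \<in> nodes P \<Longrightarrow> wb n \<in> feas P n"
    and fin: "policy_cost (parent_state P (\<lambda>k. fst (wb k))) wb < \<infinity>"
    and n0: "n0 \<in> nodes P" "n0 \<noteq> rootnode P"
    and z0: "z0 \<in> parent_states P n0" "value_fn n0 z0 < \<infinity>"
    and d: "0 < (d::real)"
  shows "\<exists>w. (\<forall>n\<in>nodes P. w n \<in> feas P n) \<and>
    parent_state P (\<lambda>k. fst (w k)) n0 = fst (wb (parent P n0)) \<and>
    policy_cost ((parent_state P (\<lambda>k. fst (w k)))(n0 := z0)) w
        + expected_value n0 (fst (wb (parent P n0)))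
      \<le> policy_cost (parent_state P (\<lambda>k. fst (wb k))) wb + expected_value n0 z0 + ereal d"
proof -
  define xb where "xb = parent_state P (\<lambda>k. fst (wb k))"
  have xb: "\<And>n. n \<in> nodes P \<Longrightarrow> xb n \<in> parent_states P n"
    unfolding xb_def using parent_state_in_parent_states[of wb, OF wb] by blast
  \<comment> \<open>The node probabilities weight the slacks, so with this choice they add up to
    \<open>d\<close> over the whole tree.\<close>
  define e where "e = d / (\<Sum>n\<in>nodes P. node_prob P n)"
  have psum: "0 < (\<Sum>n\<in>nodes P. node_prob P n)"
    using finite_nodes root_in_nodes prob_pos by (intro sum_pos) auto
  then have e: "0 < e" using d by (simp add: e_def)
  define pol where "pol n z = (if z = xb n then wb n else
      (SOME v. v \<in> feas P n \<and> stage_value n z v \<le> value_fn n z + ereal e))" for n z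
  have pol_opt: "pol n z \<in> feas P n \<and> stage_value n z (pol n z) \<le> value_fn n z + ereal e"
    if "n \<in> nodes P" "z \<in> parent_states P n" "z \<noteq> xb n" for n z
    unfolding pol_def using that(3) wb[OF that(1)] near_optimal_stage[OF that(1,2) _ e]
    by simp (rule someI_ex, blast)
  have pol_feas: "pol n z \<in> feas P n" if "n \<in> nodes P" "z \<in> parent_states P n" for n z
    using pol_opt[OF that] wb[OF that(1)] by (cases "z = xb n") (auto simp: pol_def)
  \<comment> \<open>Forward recursion in which \<open>n0\<close> reacts to \<open>z0\<close> instead
    of the state handed down by its parent; all other nodes stay coupled.\<close>
  obtain w where w: "\<And>n. n \<in> nodes P \<Longrightarrow>
      w n = pol n (if n = n0 then z0 else parent_state P (\<lambda>k. fst (w k)) n)"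
    using policy_trajectory_exists[of "\<lambda>n s. pol n (if n = n0 then z0 else s)"] by blast
  define z where "z = (parent_state P (\<lambda>k. fst (w k)))(n0 := z0)"
  have wz: "w n = pol n (z n)" if "n \<in> nodes P" for n
    using w[OF that] by (simp add: z_def)
  have z_root: "z (rootnode P) = 0" using n0 by (simp add: z_def parent_state_def)
  have z_child: "z n = fst (w (parent P n))" if "n \<noteq> rootnode P" "n \<noteq> n0" for n
    using that by (simp add: z_def parent_state_def)
  have feas_z: "w n \<in> feas P n \<and> z n \<in> parent_states P n" if "n \<in> nodes P" for n
    using that
  proof (induction n rule: node_induct)
    case root
    then show ?case
      using wz[OF root_in_nodes] pol_feas[OF root_in_nodes] z_root by (simp add: parent_states_def)
  next
    case (child n)
    then have "z n \<in> parent_states P n"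
      using z0(1) z_child[of n] by (cases "n = n0") (auto simp: z_def parent_states_def)
    then show ?case using wz pol_feas child.hyps by simp
  qed
  \<comment> \<open>Nodes of smaller depth than \<open>n0\<close> have an unaltered history, so the
    policy copies \<open>wb\<close> there. For the parent of \<open>n0\<close> this means that it
    still hands down \<open>xb n0\<close>, although \<open>n0\<close> uses
    \<open>z0\<close>.\<close>
  have before: "depth n < depth n0 \<longrightarrow> w n = wb n" if "n \<in> nodes P" for n
    using that
  proof (induction n rule: node_induct)
    case root
    then show ?case
      using wz[OF root_in_nodes] z_root by (simp add: pol_def xb_def parent_state_def)
  next
    case (child n)
    show ?case
    proof
      assume "depth n < depth n0"
      then have "z n = xb n"
        using child z_child[of n] depth_parent[of n]
        by (cases "n = n0") (auto simp: xb_def parent_state_def)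
      then show "w n = wb n" using wz child.hyps by (simp add: pol_def)
    qed
  qed
  then have at_n0: "fst (w (parent P n0)) = xb n0"
    using n0 depth_parent[OF n0] parent_in_nodes[OF n0] by (simp add: xb_def parent_state_def)

  have fin_b: "stage_value n (xb n) (wb n) < \<infinity>" if "n \<in> nodes P" for n
    unfolding xb_def using stage_value_finite[of wb, OF wb fin that] .
  then have fin_Qb: "value_fn n (xb n) < \<infinity>" if "n \<in> nodes P" for n
    using value_fn_le_stage_value[OF wb[OF that], of "xb n"] that by fastforce
  have fin_stage: "stage_value n (z n) (w n) < \<infinity>" if "n \<in> nodes P" "value_fn n (z n) < \<infinity>" for n
  proof (cases "z n = xb n")
    case True
    then show ?thesis using fin_b wz that(1) by (simp add: pol_def)
  next
    case False
    then have "stage_value n (z n) (w n) \<le> value_fn n (z n) + ereal e"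
      using pol_opt feas_z wz that(1) by auto
    also have "\<dots> < \<infinity>" using that(2) by auto
    finally show ?thesis .
  qed
  \<comment> \<open>Finiteness descends from the root: a finite value gives a finite stage value of
    the chosen decision, hence finite values at its children. At \<open>n0\<close> the chain is
    broken by \<open>z0\<close>, where finiteness is assumed.\<close>
  have fin_Q: "value_fn n (z n) < \<infinity>" if "n \<in> nodes P" for n
    using that
  proof (induction n rule: node_induct)
    case root
    show ?case using fin_Qb[OF root_in_nodes] z_root by (simp add: xb_def parent_state_def)
  next
    case (child n)
    have par: "parent P n \<in> nodes P" "n \<in> children P (parent P n)"
      using child parent_in_nodes by (auto simp: children_def)
    show ?case
    proof (cases "n = n0")
      case True
      then show ?thesis using z0 by (simp add: z_def)
    next
      case False
      then show ?thesis
        using fin_stage[OF par(1) child.IH] stage_value_finite_iff[of "parent P n"] feas_z[OF par(1)]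
          par z_child[OF child.hyps(2)] by auto
    qed
  qed

  \<comment> \<open>With equal incoming states the two gaps coincide. Otherwise the gap of
    \<open>w\<close> is at most \<open>e\<close>, while that of \<open>wb\<close> is
    nonnegative.\<close>
  have step: "stage_value n (z n) (w n) + value_fn n (xb n)
      \<le> stage_value n (xb n) (wb n) + value_fn n (z n) + ereal e" if n: "n \<in> nodes P" for n
  proof (cases "z n = xb n")
    case True
    then have "w n = wb n" using wz n by (simp add: pol_def)
    then show ?thesis
      using True e fin_b[OF n] fin_Qb[OF n] by (simp add: add_increasing2)
  next
    case False
    then have "stage_value n (z n) (w n) \<le> value_fn n (z n) + ereal e"
      using pol_opt feas_z wz n by auto
    then have "stage_value n (z n) (w n) + value_fn n (xb n)
      \<le> (value_fn n (z n) + ereal e) + stage_value n (xb n) (wb n)"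
      using value_fn_le_stage_value[OF wb[OF n]] by (rule add_mono)
    then show ?thesis by (simp add: ac_simps)
  qed
  let ?p = "\<lambda>n. ereal (node_prob P n)"
  have nnQ: "0 \<le> value_fn n (z n)" "0 \<le> value_fn n (xb n)" if "n \<in> nodes P" for n
    using value_fn_nonneg that feas_z xb by auto
  have nnS: "0 \<le> stage_value n (z n) (w n)" "0 \<le> stage_value n (xb n) (wb n)" if "n \<in> nodes P" for n
    using nnQ[OF that] value_fn_le_stage_value[of _ n] feas_z[OF that] wb[OF that]
    by (meson order_trans)+
  have "?p n * stage_value n (z n) (w n) + ?p n * value_fn n (xb n)
      \<le> ?p n * stage_value n (xb n) (wb n) + ?p n * value_fn n (z n) + ?p n * ereal e"
    if n: "n \<in> nodes P" for n
    using ereal_mult_left_mono[OF step[OF n], of "?p n"] prob_pos[OF n] nnQ[OF n] nnS[OF n] e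
    by (simp add: ereal_right_distrib less_imp_le)
  then have "(\<Sum>n\<in>nodes P. ?p n * stage_value n (z n) (w n) + ?p n * value_fn n (xb n))
      \<le> (\<Sum>n\<in>nodes P. ?p n * stage_value n (xb n) (wb n) + ?p n * value_fn n (z n) + ?p n * ereal e)"
    by (rule sum_mono)
  then have "(\<Sum>n\<in>nodes P. ?p n * stage_value n (z n) (w n)) + (\<Sum>n\<in>nodes P. expected_value n (xb n))
      \<le> (\<Sum>n\<in>nodes P. ?p n * stage_value n (xb n) (wb n)) + (\<Sum>n\<in>nodes P. expected_value n (z n))
        + (\<Sum>n\<in>nodes P. ?p n * ereal e)"
    by (simp only: sum.distrib)
  also have "(\<Sum>n\<in>nodes P. ?p n * ereal e) = ereal d"
    using psum by (simp add: e_def sum_divide_distrib[symmetric] sum_distrib_right[symmetric])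
  also have "(\<Sum>n\<in>nodes P. ?p n * stage_value n (z n) (w n)) =
      policy_cost z w + (\<Sum>m\<in>nodes P - {rootnode P}. expected_value m (fst (w (parent P m))))"
    by (rule expected_stage_value_sum) (use feas_z in auto)
  also have "(\<Sum>n\<in>nodes P. ?p n * stage_value n (xb n) (wb n)) =
      policy_cost xb wb + (\<Sum>m\<in>nodes P - {rootnode P}. expected_value m (fst (wb (parent P m))))"
    by (rule expected_stage_value_sum) (use wb xb in auto)
  also have "(\<Sum>m\<in>nodes P - {rootnode P}. expected_value m (fst (wb (parent P m)))) =
      (\<Sum>m\<in>nodes P - {rootnode P}. expected_value m (xb m))"
    by (rule sum.cong) (auto simp: xb_def parent_state_def)
  \<comment> \<open>Handed-down and used states agree except at \<open>n0\<close>, where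
    \<open>xb n0\<close> is handed down and \<open>z0\<close> is used; this mismatch is all that
    survives the cancellation.\<close>
  also have "(\<Sum>m\<in>nodes P - {rootnode P}. expected_value m (fst (w (parent P m)))) =
      expected_value n0 (xb n0) + (\<Sum>m\<in>nodes P - {rootnode P} - {n0}. expected_value m (z m))"
    using n0 finite_nodes
    by (subst sum.remove[of _ n0])
      (auto simp: at_n0 z_child intro!: arg_cong2[where f="(+)"] sum.cong)
  also have "(\<Sum>n\<in>nodes P. expected_value n (z n)) = expected_value (rootnode P) 0 +
      (expected_value n0 z0 + (\<Sum>m\<in>nodes P - {rootnode P} - {n0}. expected_value m (z m)))"
    using n0 finite_nodes root_in_nodes z_root
    by (subst sum.remove[of _ "rootnode P"], simp, simp, subst sum.remove[of _ n0]) (auto simp: z_def)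
  also have "(\<Sum>n\<in>nodes P. expected_value n (xb n)) = expected_value (rootnode P) 0 +
      (\<Sum>m\<in>nodes P - {rootnode P}. expected_value m (xb m))"
    using finite_nodes root_in_nodes
    by (subst sum.remove[of _ "rootnode P"]) (auto simp: xb_def parent_state_def)
  finally have main: "policy_cost z w + (expected_value n0 (xb n0) +
        (\<Sum>m\<in>nodes P - {rootnode P} - {n0}. expected_value m (z m))) +
      (expected_value (rootnode P) 0 + (\<Sum>m\<in>nodes P - {rootnode P}. expected_value m (xb m)))
    \<le> policy_cost xb wb + (\<Sum>m\<in>nodes P - {rootnode P}. expected_value m (xb m)) +
      (expected_value (rootnode P) 0 + (expected_value n0 z0 +
        (\<Sum>m\<in>nodes P - {rootnode P} - {n0}. expected_value m (z m)))) + ereal d" .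

  have fin_e: "\<bar>expected_value n (z n)\<bar> \<noteq> \<infinity>" "\<bar>expected_value n (xb n)\<bar> \<noteq> \<infinity>" if "n \<in> nodes P" for n
    using fin_Q[OF that] fin_Qb[OF that] nnQ[OF that] prob_pos[OF that] by auto
  have fin_s: "\<bar>\<Sum>m\<in>nodes P - {rootnode P} - {n0}. expected_value m (z m)\<bar> \<noteq> \<infinity>"
      "\<bar>\<Sum>m\<in>nodes P - {rootnode P}. expected_value m (xb m)\<bar> \<noteq> \<infinity>"
    using fin_e by (auto simp: sum_Inf)
  have "policy_cost z w + expected_value n0 (xb n0) \<le> policy_cost xb wb + expected_value n0 z0 + ereal d"
    by (rule ereal_cancel[OF main fin_s fin_e(1)[OF root_in_nodes, unfolded z_root]])
  moreover have "parent_state P (\<lambda>k. fst (w k)) n0 = fst (wb (parent P n0))" "xb n0 = fst (wb (parent P n0))"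
    using at_n0 n0 by (simp_all add: parent_state_def xb_def)
  ultimately show ?thesis
    using feas_z unfolding z_def xb_def by (intro exI[of _ w]) auto
qed

end

section \<open>Exact penalties and tight cuts\<close>

lemma compact_parent_states:
  assumes "scenario_tree P" "\<And>n. n \<in> nodes P \<Longrightarrow> compact (feas P n)" "n \<in> nodes P"
  shows "compact (parent_states P n :: 'x::{t2_space, zero} set)"
  using assms scenario_tree.parent_in_nodes[OF assms(1)]
  by (auto simp: parent_states_def intro!: compact_continuous_image continuous_on_fst continuous_on_id)

text \<open>The objective is a finite sum of nonnegative lower semicontinuous terms on a product of
  compact sets, so its infimum is attained.\<close>

lemma reg_minimizer_exists:
  fixes P :: "('n, 'x::euclidean_space, 'y::euclidean_space) program"
  assumes tree: "scenario_tree P"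
    and feas_compact: "\<And>n. n \<in> nodes P \<Longrightarrow> compact (feas P n)"
    and cost_nonneg: "\<And>n z x y. n \<in> nodes P \<Longrightarrow> z \<in> parent_states P n \<Longrightarrow>
          (x, y) \<in> feas P n \<Longrightarrow> 0 \<le> cost P n z y x"
    and cost_lsc: "\<And>n. n \<in> nodes P \<Longrightarrow>
          lsc_on {(z, y, x). z \<in> parent_states P n \<and> (x, y) \<in> feas P n}
            (\<lambda>(z, y, x). cost P n z y x)"
    and psi_nonneg: "\<And>n x. n \<in> nodes P \<Longrightarrow> 0 \<le> psi n x"
    and psi_cont: "\<And>n. n \<in> nodes P \<Longrightarrow>
          continuous_on {u - v | u v. u \<in> parent_states P n \<and> v \<in> parent_states P n} (psi n)"
    and sig: "\<And>n. n \<in> nodes P \<Longrightarrow> 0 \<le> sig n"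
    and ex: "reg_feasible_sol P s0"
  shows "\<exists>s. is_arg_min (reg_total_cost P sig psi) (reg_feasible_sol P) s"
proof -
  interpret scenario_tree P by fact
  \<comment> \<open>Solutions are functions on the whole type \<open>'n\<close>; coordinates outside
    the tree are pinned to 0 so that the product is compact.\<close>
  define K :: "'n \<Rightarrow> (('x \<times> 'y) \<times> 'x) set" where
    "K n = (if n \<in> nodes P then feas P n \<times> parent_states P n else {0})" for n
  let ?S = "Pi UNIV K"
  have mem: "fst (w n) \<in> feas P n" "snd (w n) \<in> parent_states P n" if "w \<in> ?S" "n \<in> nodes P" for w n
  proof -
    have "w n \<in> K n" using that(1) by auto
    then show "fst (w n) \<in> feas P n" "snd (w n) \<in> parent_states P n"
      using that(2) by (auto simp: K_def)
  qed
  define summand :: "'n \<Rightarrow> ('n \<Rightarrow> ('x \<times> 'y) \<times> 'x) \<Rightarrow> ereal"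
    where "summand n = (\<lambda>w. ereal (node_prob P n) *
      (cost P n (snd (w n)) (snd (fst (w n))) (fst (fst (w n))) +
       ereal (sig n * psi n (parent_state P (\<lambda>k. fst (fst (w k))) n - snd (w n)))))"
    for n
  define sol where "sol w = (\<lambda>n. fst (fst (w n)), \<lambda>n. snd (fst (w n)), \<lambda>n. snd (w n))"
    for w :: "'n \<Rightarrow> ('x \<times> 'y) \<times> 'x"
  have coord: "continuous_on ?S (\<lambda>w. w n)" for n
    by (rule continuous_on_subset[OF continuous_on_product_coordinates]) simp
  have state: "parent_state P (\<lambda>k. fst (fst (w k))) n \<in> parent_states P n"
    if "w \<in> ?S" "n \<in> nodes P" for w n
    using mem(1)[OF that(1)] that(2) parent_in_nodes by (auto simp: parent_state_def parent_states_def)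
  have nn: "0 \<le> cost P n (snd (w n)) (snd (fst (w n))) (fst (fst (w n)))"
    if "w \<in> ?S" "n \<in> nodes P" for w n
    using cost_nonneg[of n "snd (w n)" "fst (fst (w n))" "snd (fst (w n))"] mem[OF that] that(2) by simp
  have lsc_summand: "lsc_on ?S (summand n)" if n: "n \<in> nodes P" for n
  proof -
    have "lsc_on ?S (\<lambda>w. (\<lambda>(z, y, x). cost P n z y x) (snd (w n), snd (fst (w n)), fst (fst (w n))))"
      by (rule lsc_on_compose[OF cost_lsc[OF n]])
        (use mem n in \<open>auto intro!: continuous_intros coord\<close>)
    moreover have "continuous_on ?S (\<lambda>w. parent_state P (\<lambda>k. fst (fst (w k))) n - snd (w n))"
      by (cases "n = rootnode P") (auto simp: parent_state_def intro!: continuous_intros coord)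
    \<comment> \<open>\<open>psi n\<close> is continuous only on differences of admissible parent
      states, and \<open>state\<close> keeps its argument there.\<close>
    then have "continuous_on ?S (\<lambda>w. psi n (parent_state P (\<lambda>k. fst (fst (w k))) n - snd (w n)))"
      by (rule continuous_on_compose2[OF psi_cont[OF n]]) (use state mem n in blast)
    then have "lsc_on ?S (\<lambda>w. ereal (sig n * psi n (parent_state P (\<lambda>k. fst (fst (w k))) n - snd (w n))))"
      by (intro lsc_on_continuous continuous_on_mult_left)
    ultimately show ?thesis
      unfolding summand_def
      using nn n psi_nonneg[OF n] sig[OF n] prob_pos[OF n]
      by (intro lsc_on_cmult lsc_on_add) auto
  qed
  have lsc: "lsc_on ?S (\<lambda>w. \<Sum>n\<in>nodes P. summand n w)"
  proof (rule lsc_on_sum[OF lsc_summand])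
    fix n w assume "n \<in> nodes P" "w \<in> ?S"
    then show "0 \<le> summand n w"
      using nn[of w n] psi_nonneg[of n] sig[of n] prob_pos[of n]
      by (auto simp: summand_def intro!: add_nonneg_nonneg)
  qed
  have compact: "compact ?S"
    using feas_compact compact_parent_states[OF tree feas_compact]
    by (intro compact_Pi_UNIV) (auto simp: K_def intro!: compact_Times)
  \<comment> \<open>Resetting a solution outside the tree leaves its cost unchanged, so minimizing
    over the compact product minimizes over all regularized solutions.\<close>
  have *: "\<exists>w\<in>?S. \<forall>n\<in>nodes P. w n = ((x n, y n), z n)"
    if "reg_feasible_sol P (x, y, z)" for x y z
    using that
    by (intro bexI[of _ "\<lambda>n. if n \<in> nodes P then ((x n, y n), z n) else 0"])
      (auto simp: K_def reg_feasible_sol_def)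
  have ne: "?S \<noteq> {}" using *[of "fst s0" "fst (snd s0)" "snd (snd s0)"] ex by auto
  obtain w where w: "w \<in> ?S" "\<And>v. v \<in> ?S \<Longrightarrow> (\<Sum>n\<in>nodes P. summand n w) \<le> (\<Sum>n\<in>nodes P. summand n v)"
    using lsc_on_attains_inf[OF compact ne lsc] by auto
  have "is_arg_min (reg_total_cost P sig psi) (reg_feasible_sol P) (sol w)"
    unfolding is_arg_min_linorder
  proof (intro conjI allI impI)
    show "reg_feasible_sol P (sol w)"
      using mem[OF w(1)] by (simp add: reg_feasible_sol_def sol_def)
    fix s assume s: "reg_feasible_sol P s"
    obtain x y z where xyz: "s = (x, y, z)" by (cases s)
    obtain v where v: "v \<in> ?S" "\<And>n. n \<in> nodes P \<Longrightarrow> v n = ((x n, y n), z n)"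
      using *[OF s[unfolded xyz]] by auto
    have "reg_total_cost P sig psi (sol w) = (\<Sum>n\<in>nodes P. summand n w)"
      by (simp add: reg_total_cost_def sol_def summand_def)
    also have "\<dots> \<le> (\<Sum>n\<in>nodes P. summand n v)" by (rule w(2)[OF v(1)])
    also have "\<dots> = reg_total_cost P sig psi s"
      unfolding reg_total_cost_def xyz prod.case
      by (rule sum.cong) (auto simp: summand_def v(2) parent_state_def parent_in_nodes)
    finally show "reg_total_cost P sig psi (sol w) \<le> reg_total_cost P sig psi s" .
  qed
  then show ?thesis ..
qed

text \<open>Exactness speaks of minimizers only, hence the existence premise. At a minimizer the
  penalties vanish, so its value is the original cost of a feasible solution and cannot be below the
  optimum.\<close>

lemma exact_penalty_lower_bound:
  assumes exact: "exact_penalty P sig psi"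
    and ex: "\<exists>s. is_arg_min (reg_total_cost P sig psi) (reg_feasible_sol P) s"
    and psi_0: "\<And>n. n \<in> nodes P \<Longrightarrow> psi n 0 = 0"
    and opt: "is_arg_min (total_cost P) (feasible_sol P) (xb, yb)"
    and s: "reg_feasible_sol P s"
  shows "total_cost P (xb, yb) \<le> reg_total_cost P sig psi s"
proof -
  obtain x y z where arg: "is_arg_min (reg_total_cost P sig psi) (reg_feasible_sol P) (x, y, z)"
    using ex by (metis prod_cases3)
  then have z: "z n = parent_state P x n" if "n \<in> nodes P" for n
    using exact that by (auto simp: exact_penalty_def)
  have "feasible_sol P (x, y)"
    using arg by (auto simp: is_arg_min_def reg_feasible_sol_def feasible_sol_def)
  then have "total_cost P (xb, yb) \<le> total_cost P (x, y)"
    using opt by (auto simp: is_arg_min_linorder)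
  also have "\<dots> = reg_total_cost P sig psi (x, y, z)"
    unfolding total_cost_def reg_total_cost_def prod.case
    by (rule sum.cong) (auto simp: z psi_0)
  also have "\<dots> \<le> reg_total_cost P sig psi s"
    using arg s unfolding is_arg_min_linorder by blast
  finally show ?thesis .
qed

theorem proposition3:
  fixes P :: "('n, 'x::euclidean_space, 'y::euclidean_space) program"
    and nrm :: "'x \<Rightarrow> real"
    and psi :: "'n \<Rightarrow> 'x \<Rightarrow> real"
    and sig l_lam l_rho :: "'n \<Rightarrow> real"
    and xbar :: "'n \<Rightarrow> 'x" and ybar :: "'n \<Rightarrow> 'y"
    and vhat :: "'n \<Rightarrow> ereal" and lamhat :: "'n \<Rightarrow> 'x" and rhohat :: "'n \<Rightarrow> real"
  assumes tree: "scenario_tree P"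
    and feas_compact: "\<And>n. n \<in> nodes P \<Longrightarrow> compact (feas P n)"
    and cost_nonneg: "\<And>n z x y. n \<in> nodes P \<Longrightarrow> z \<in> parent_states P n \<Longrightarrow>
          (x, y) \<in> feas P n \<Longrightarrow> 0 \<le> cost P n z y x"
    and cost_lsc: "\<And>n. n \<in> nodes P \<Longrightarrow>
          lsc_on {(z, y, x). z \<in> parent_states P n \<and> (x, y) \<in> feas P n}
            (\<lambda>(z, y, x). cost P n z y x)"
    and finite_cost: "\<exists>x y. feasible_sol P (x, y) \<and> total_cost P (x, y) < \<infinity>"
    and norm: "is_norm nrm"
    and penalty: "\<And>n. n \<in> nodes P \<Longrightarrow> penalty_function (psi n)"
    and penalty_lipschitz: "\<And>n. n \<in> nodes P \<Longrightarrow>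
          lipschitz1_wrt nrm {u - v | u v. u \<in> parent_states P n \<and> v \<in> parent_states P n} (psi n)"
    and sigma_pos: "\<And>n. n \<in> nodes P \<Longrightarrow> 0 < sig n"
    and exactness: "exact_penalty P sig psi"
    and l_lam_nonneg: "\<And>n. n \<in> nodes P - {rootnode P} \<Longrightarrow> 0 \<le> l_lam n"
    and l_rho_nonneg: "\<And>n. n \<in> nodes P - {rootnode P} \<Longrightarrow> 0 \<le> l_rho n"
    and l_rho_ge: "\<And>n. n \<in> nodes P - {rootnode P} \<Longrightarrow> sig n \<le> l_rho n"
    and optimal: "is_arg_min (total_cost P) (feasible_sol P) (xbar, ybar)"
    and vhat: "\<And>n. n \<in> nodes P - {rootnode P} \<Longrightarrow>
          vhat n = (SUP u\<in>dual_set nrm (l_lam n) (l_rho n).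
            inner_value P psi n (xbar (parent P n)) u)"
    and outer_optimal: "\<And>n. n \<in> nodes P - {rootnode P} \<Longrightarrow>
          is_arg_max (inner_value P psi n (xbar (parent P n)))
            (\<lambda>u. u \<in> dual_set nrm (l_lam n) (l_rho n)) (lamhat n, rhohat n)"
  shows "\<forall>n\<in>nodes P - {rootnode P}.
    scenario_tree.value_fn P n (xbar (parent P n)) =
      conjugacy_cut (psi n) (xbar (parent P n)) (lamhat n) (rhohat n) (vhat n) (xbar (parent P n))"
proof
  fix n assume "n \<in> nodes P - {rootnode P}"
  then have n: "n \<in> nodes P" "n \<noteq> rootnode P" and n': "n \<in> nodes P - {rootnode P}" by auto
  interpret nonneg_program P
    using tree cost_nonneg by (simp add: nonneg_program_def nonneg_program_axioms_def)
  define wb where "wb k = (xbar k, ybar k)" for k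
  let ?xb = "xbar (parent P n)"
  have psi0: "psi k 0 = 0" and psi_nn: "0 \<le> psi k v" if "k \<in> nodes P" for k v
    using penalty[OF that] by (auto simp: penalty_function_def)
  have wb: "wb k \<in> feas P k" if "k \<in> nodes P" for k
    using optimal that by (auto simp: is_arg_min_def feasible_sol_def wb_def)
  have cost_wb: "policy_cost (parent_state P (\<lambda>k. fst (wb k))) wb = total_cost P (xbar, ybar)"
    by (simp add: policy_cost_def total_cost_def wb_def)
  have fin: "total_cost P (xbar, ybar) < \<infinity>"
    using finite_cost optimal by (auto simp: is_arg_min_linorder intro: le_less_trans)
  have xb: "?xb \<in> parent_states P n"
    using wb[OF parent_in_nodes[OF n]] n by (force simp: parent_states_def wb_def)
  have "reg_feasible_sol P (xbar, ybar, parent_state P (\<lambda>k. fst (wb k)))"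
    using wb parent_state_in_parent_states[of wb, OF wb] by (simp add: reg_feasible_sol_def wb_def)
  then have ex: "\<exists>s. is_arg_min (reg_total_cost P sig psi) (reg_feasible_sol P) s"
    using psi_nn sigma_pos lipschitz1_wrt_continuous_on[OF norm penalty_lipschitz]
    by (intro reg_minimizer_exists[OF tree feas_compact cost_nonneg cost_lsc]) (auto intro: less_imp_le)
  have lower: "value_fn n ?xb \<le> value_fn n z + ereal (sig n * psi n (?xb - z))"
    if z: "z \<in> parent_states P n" for z
  proof (cases "value_fn n z = \<infinity>")
    case False
    show ?thesis
    proof (rule ereal_le_epsilon2)
      fix e :: real assume e: "0 < e"
      let ?p = "node_prob P n"
      have p: "0 < ?p" using prob_pos n by simp
      \<comment> \<open>\<open>restart_policy\<close> works with expected values, so its slack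
        carries the factor \<open>?p\<close>, which is divided out in the end.\<close>
      obtain w where w: "\<And>k. k \<in> nodes P \<Longrightarrow> w k \<in> feas P k"
        and wn: "parent_state P (\<lambda>k. fst (w k)) n = ?xb"
        and le: "policy_cost ((parent_state P (\<lambda>k. fst (w k)))(n := z)) w + expected_value n ?xb
          \<le> total_cost P (xbar, ybar) + expected_value n z + ereal (?p * e)"
        using restart_policy[of wb n z "?p * e"] wb cost_wb fin n z False p e by (auto simp: wb_def)
      define s where "s = (parent_state P (\<lambda>k. fst (w k)))(n := z)"
      let ?r = "sig n * psi n (?xb - z)"
      have "reg_feasible_sol P (\<lambda>k. fst (w k), \<lambda>k. snd (w k), s)"
        using w z parent_state_in_parent_states[of w, OF w] by (simp add: reg_feasible_sol_def s_def)
      then have "total_cost P (xbar, ybar)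
          \<le> reg_total_cost P sig psi (\<lambda>k. fst (w k), \<lambda>k. snd (w k), s)"
        by (intro exact_penalty_lower_bound[OF exactness ex _ optimal] psi0)
      \<comment> \<open>\<open>s\<close> differs from the handed-down states only at
        \<open>n\<close>, so every other penalty is \<open>psi k 0\<close>, which is 0.\<close>
      also have "\<dots> = (\<Sum>k\<in>nodes P. ereal (node_prob P k) * cost P k (s k) (snd (w k)) (fst (w k))
          + (if k = n then ereal (?p * ?r) else 0))"
        unfolding reg_total_cost_def prod.case
      proof (rule sum.cong)
        fix k assume k: "k \<in> nodes P"
        have distrib: "ereal a * (c + ereal b) = ereal a * c + ereal (a * b)" if "0 < a" for a b c
          using that by (cases c) (auto simp: distrib_left)
        show "ereal (node_prob P k) * (cost P k (s k) (snd (w k)) (fst (w k)) +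
            ereal (sig k * psi k (parent_state P (\<lambda>k. fst (w k)) k - s k))) =
          ereal (node_prob P k) * cost P k (s k) (snd (w k)) (fst (w k))
            + (if k = n then ereal (?p * ?r) else 0)"
          using prob_pos[OF k] psi0[OF k] wn by (simp add: distrib s_def)
      qed simp
      also have "\<dots> = policy_cost s w + ereal (?p * ?r)"
        using n finite_nodes by (simp add: policy_cost_def sum.distrib)
      finally have "total_cost P (xbar, ybar) \<le> policy_cost s w + ereal (?p * ?r)" .
      moreover have "0 \<le> total_cost P (xbar, ybar)"
        unfolding cost_wb[symmetric] policy_cost_def
        using wb parent_state_in_parent_states[of wb, OF wb] cost_nonneg prob_pos
        by (intro sum_nonneg mult_nonneg_nonneg) (auto simp: wb_def less_imp_le)
      moreover have "0 \<le> value_fn n ?xb" "0 \<le> value_fn n z"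
        using value_fn_nonneg n xb z by auto
      ultimately show "value_fn n ?xb \<le> value_fn n z + ereal ?r + ereal e"
        using ereal_combine[OF le[folded s_def] _ p _ fin _ False] by blast
    qed
  qed simp
  \<comment> \<open>The multiplier \<open>(0, sig n)\<close> is admissible because the dual norm of
    0 is 0 and \<open>sig n\<close> is at most \<open>l_rho n\<close>.\<close>
  have "value_fn n ?xb \<le> inner_value P psi n ?xb (0, sig n)"
    using lower by (auto simp: inner_value_def intro!: INF_greatest)
  also have "\<dots> \<le> vhat n"
    unfolding vhat[OF n']
    using dual_norm_zero[OF norm] l_lam_nonneg[OF n'] l_rho_ge[OF n'] sigma_pos[OF n(1)]
    by (intro SUP_upper) (auto simp: dual_set_def)
  finally have "value_fn n ?xb \<le> vhat n" .
  \<comment> \<open>Weak duality: the inner infimum is bounded by its value at \<open>?xb\<close>,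
    where both multiplier terms vanish.\<close>
  moreover have "vhat n \<le> value_fn n ?xb"
    unfolding vhat[OF n']
  proof (rule SUP_least)
    fix u
    show "inner_value P psi n ?xb u \<le> value_fn n ?xb"
      using INF_lower[OF xb, of "\<lambda>z. value_fn n z + ereal (fst u \<bullet> (?xb - z) + snd u * psi n (?xb - z))"]
        psi0[OF n(1)] by (simp add: inner_value_def case_prod_beta)
  qed
  \<comment> \<open>At its own base point the cut reduces to \<open>vhat n\<close>.\<close>
  ultimately show "value_fn n ?xb = conjugacy_cut (psi n) ?xb (lamhat n) (rhohat n) (vhat n) ?xb"
    using psi0[OF n(1)] by (simp add: conjugacy_cut_def)
qed

end
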